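(* Let $N\ge3$, $0\le p\le\lfloor N/2\rfloor-1$, $\nu_1,\dots,\nu_{p+1}\in\mathbb C$ and $\mathcal F=\mathcal F^{\mathcal P}_{p\prec0}(\nu_1,\dots,\nu_{p+1})$. Let $\mathfrak s\subset sl(N)$ be the subalgebra spanned by $E_{ij}$ ($i\ne j$) and $E_{ii}-E_{jj}$ with $p+2\le i,j\le N-p-1$ (a copy of $sl(N-2p-2)$). Then every $X\in\mathfrak s$ remains primitive in the twisted Hopf algebra: $\mathcal F\,\Delta(X)\,\mathcal F^{-1}=X\otimes1+1\otimes X$.
   Context: Work over $\mathbb C$ with $U=U(sl(N))$ with primitive generators ($\Delta(x)=x\otimes1+1\otimes x$). $E_{ij}$ are matrix units of $gl(N)$, $I=\sum_sE_{ss}$. $\xi$ is a formal parameter and all computations are in $\xi$-adically completed algebras $U[[\xi]]$, $(U\otimes U)[[\xi]]$. $\sigma_{ij}(c):=\ln(1+\xi cE_{ij})$, $H^{\mathcal P}_k:=E_{kk}-\frac1NI$. For $0\le k\le\lfloor N/2\rfloor-1$, $\mathcal F^{\mathcal P}_k(\nu):=\big(\prod_{s=k+2}^{N-k-1}\exp(\xi\nu E_{k+1,s}\otimes E_{s,N-k})\big)\exp(H^{\mathcal P}_{k+1}\otimes\sigma_{k+1,N-k}(\nu))$, and $\mathcal F^{\mathcal P}_{p\prec0}(\nu_1,\dots,\nu_{p+1}):=\mathcal F^{\mathcal P}_p(\nu_{p+1})\cdots\mathcal F^{\mathcal P}_0(\nu_1)$. *)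

theory Defs
  imports Complex_Main "HOL-Computational_Algebra.Formal_Power_Series"
begin

(* An associative complex algebra is modelled as a ring 'a together with a
   ring homomorphism sc : complex => 'a onto central elements (scalars). *)
definition cplx_alg :: "(complex \<Rightarrow> 'a::ring_1) \<Rightarrow> bool" where
  "cplx_alg sc \<longleftrightarrow> sc 0 = 0 \<and> sc 1 = 1 \<and>
     (\<forall>a b. sc (a + b) = sc a + sc b) \<and> (\<forall>a b. sc (a * b) = sc a * sc b) \<and>
     (\<forall>a x. sc a * x = x * sc a)"

definition gl_rep :: "nat \<Rightarrow> (nat \<Rightarrow> nat \<Rightarrow> 'a::ring_1) \<Rightarrow> bool" where
  "gl_rep N e \<longleftrightarrow> (\<forall>i\<in>{1..N}. \<forall>j\<in>{1..N}. \<forall>k\<in>{1..N}. \<forall>l\<in>{1..N}.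
     e i j * e k l - e k l * e i j
       = (if j = k then e i l else 0) - (if l = i then e k j else 0))"

(* the two tensor legs commute: E_ij (x) 1 and 1 (x) E_kl *)
definition legs_commute :: "nat \<Rightarrow> (nat \<Rightarrow> nat \<Rightarrow> 'a::ring_1) \<Rightarrow> (nat \<Rightarrow> nat \<Rightarrow> 'a) \<Rightarrow> bool" where
  "legs_commute N e1 e2 \<longleftrightarrow> (\<forall>i\<in>{1..N}. \<forall>j\<in>{1..N}. \<forall>k\<in>{1..N}. \<forall>l\<in>{1..N}.
     e1 i j * e2 k l = e2 k l * e1 i j)"

(* exp of a formal power series in xi with zero constant term:
   coefficient n of sum_k A^k/k! only involves k <= n *)
definition fexp :: "(complex \<Rightarrow> 'a::ring_1) \<Rightarrow> 'a fps \<Rightarrow> 'a fps" where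
  "fexp sc A = Abs_fps (\<lambda>n. \<Sum>k\<le>n. sc (1 / of_nat (fact k)) * fps_nth (A ^ k) n)"

definition fln1p :: "(complex \<Rightarrow> 'a::ring_1) \<Rightarrow> 'a \<Rightarrow> 'a fps" where
  "fln1p sc x = Abs_fps (\<lambda>n. if n = 0 then 0 else sc ((-1) ^ (n + 1) / of_nat n) * x ^ n)"

definition Iden :: "nat \<Rightarrow> (nat \<Rightarrow> nat \<Rightarrow> 'a::ring_1) \<Rightarrow> 'a" where
  "Iden N e = (\<Sum>s=1..N. e s s)"

definition HP :: "(complex \<Rightarrow> 'a::ring_1) \<Rightarrow> nat \<Rightarrow> (nat \<Rightarrow> nat \<Rightarrow> 'a) \<Rightarrow> nat \<Rightarrow> 'a" where
  "HP sc N e k = e k k - sc (1 / of_nat N) * Iden N e"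

definition sigmaP :: "(complex \<Rightarrow> 'a::ring_1) \<Rightarrow> (nat \<Rightarrow> nat \<Rightarrow> 'a) \<Rightarrow> nat \<Rightarrow> nat \<Rightarrow> complex \<Rightarrow> 'a fps" where
  "sigmaP sc e i j c = fln1p sc (sc c * e i j)"

(* F^P_k(nu); first tensor leg = e1, second = e2 *)
definition FP :: "(complex \<Rightarrow> 'a::ring_1) \<Rightarrow> nat \<Rightarrow> (nat \<Rightarrow> nat \<Rightarrow> 'a) \<Rightarrow> (nat \<Rightarrow> nat \<Rightarrow> 'a)
                   \<Rightarrow> nat \<Rightarrow> complex \<Rightarrow> 'a fps" where
  "FP sc N e1 e2 k \<nu> =
     prod_list (map (\<lambda>s. fexp sc (fps_X * fps_const (sc \<nu> * e1 (k+1) s * e2 s (N-k))))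
                    [k+2..<N-k])
     * fexp sc (fps_const (HP sc N e1 (k+1)) * sigmaP sc e2 (k+1) (N-k) \<nu>)"

definition FPchain :: "(complex \<Rightarrow> 'a::ring_1) \<Rightarrow> nat \<Rightarrow> (nat \<Rightarrow> nat \<Rightarrow> 'a) \<Rightarrow> (nat \<Rightarrow> nat \<Rightarrow> 'a)
                   \<Rightarrow> nat \<Rightarrow> (nat \<Rightarrow> complex) \<Rightarrow> 'a fps" where
  "FPchain sc N e1 e2 p \<nu> = prod_list (map (\<lambda>k. FP sc N e1 e2 k (\<nu> (k+1))) (rev [0..<p+1]))"

end

(* For k <= p the indices k+1 and N-k of the factor F^P_k lie outside the inner block
   {p+2..N-p-1}, so H^P_{k+1} (I is central) and E_{k+1,N-k} commute with Delta(E_ij) for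
   i, j in the block.  The single terms E_{k+1,s} (x) E_{s,N-k} do not, but they commute
   pairwise, so the product of their exponentials is the exponential of their sum over s,
   and this contraction over the inner index commutes with Delta(E_ij).  Hence every factor,
   and so F, commutes with Delta(X); F has constant term 1 and is therefore invertible. *)

theory Submission
  imports Defs
begin

unbundle fps_syntax

definition commutes :: "'a::times \<Rightarrow> 'a \<Rightarrow> bool" where
  "commutes x y \<longleftrightarrow> x * y = y * x"

lemma commutes_sym: "commutes x y \<Longrightarrow> commutes y x"
  by (simp add: commutes_def)

lemma commutes_mult_left:
  fixes x y z :: "'a::semigroup_mult"
  shows "commutes x z \<Longrightarrow> commutes y z \<Longrightarrow> commutes (x * y) z"
  by (simp add: commutes_def) (metis mult.assoc)

lemma commutes_mult_right:
  fixes x y z :: "'a::semigroup_mult"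
  shows "commutes z x \<Longrightarrow> commutes z y \<Longrightarrow> commutes z (x * y)"
  by (simp add: commutes_def) (metis mult.assoc)

lemma commutes_add_right:
  fixes x y z :: "'a::semiring"
  shows "commutes z x \<Longrightarrow> commutes z y \<Longrightarrow> commutes z (x + y)"
  by (simp add: commutes_def distrib_left distrib_right)

lemma commutes_diff_left:
  fixes x y z :: "'a::ring"
  shows "commutes x z \<Longrightarrow> commutes y z \<Longrightarrow> commutes (x - y) z"
  by (simp add: commutes_def left_diff_distrib right_diff_distrib)

lemma commutes_sum_left:
  fixes z :: "'a::semiring_0"
  shows "(\<And>i. i \<in> A \<Longrightarrow> commutes (f i) z) \<Longrightarrow> commutes (sum f A) z"
  by (simp add: commutes_def sum_distrib_left sum_distrib_right)

lemma commutes_sum_list_left: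
  fixes z :: "'a::semiring_0"
  shows "(\<And>x. x \<in> set xs \<Longrightarrow> commutes (f x) z) \<Longrightarrow> commutes (sum_list (map f xs)) z"
  by (induct xs) (auto simp: commutes_def distrib_left distrib_right)

lemma commutes_prod_list_left:
  fixes z :: "'a::monoid_mult"
  shows "(\<And>x. x \<in> set xs \<Longrightarrow> commutes x z) \<Longrightarrow> commutes (prod_list xs) z"
  by (induct xs) (simp_all add: commutes_mult_left, simp add: commutes_def)

lemma commutes_power_left:
  fixes x z :: "'a::monoid_mult"
  shows "commutes x z \<Longrightarrow> commutes (x ^ n) z"
  by (simp add: commutes_def power_commuting_commutes)

lemma commutes_zero_left: "commutes (0::'a::mult_zero) z"
  by (simp add: commutes_def)

lemma cplx_algD:
  assumes "cplx_alg sc"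
  shows "sc 0 = 0" "sc 1 = 1" "sc (a + b) = sc a + sc b" "sc (a * b) = sc a * sc b"
    and "commutes (sc a) x"
  using assms unfolding cplx_alg_def commutes_def by blast+

lemma cplx_alg_of_nat: "cplx_alg sc \<Longrightarrow> sc (of_nat n) = of_nat n"
  by (induct n) (simp_all add: cplx_algD)

(* The library's binomial_ring needs a commutative semiring. *)
lemma binomial_commuting:
  fixes a b :: "'a::semiring_1"
  assumes "commutes a b"
  shows "(a + b) ^ n = (\<Sum>k\<le>n. of_nat (n choose k) * a ^ k * b ^ (n - k))"
proof (induct n)
  case 0
  then show ?case by simp
next
  case (Suc n)
  have ba: "b * a ^ k = a ^ k * b" for k
    using commutes_power_left[OF assms] by (simp add: commutes_def)
  have decomp: "{0..n+1} = {0} \<union> {n + 1} \<union> {1..n}"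
    by auto
  have bterm: "b * (of_nat c * a^k * b^m) = of_nat c * a^k * b^(m + 1)" for c k m
  proof -
    have "b * (of_nat c * a^k * b^m) = of_nat c * (b * a^k) * b^m"
      by (simp add: mult_of_nat_commute mult.assoc)
    then show ?thesis by (simp add: ba mult.assoc)
  qed
  have aterm: "a * (of_nat c * a^k * b^m) = of_nat c * a^(k + 1) * b^m" for c k m
    by (simp add: mult_of_nat_commute mult.assoc)
  have "(a + b)^(n+1) = (a + b) * (\<Sum>k\<le>n. of_nat (n choose k) * a^k * b^(n - k))"
    using Suc.hyps by simp
  also have "\<dots> = a * (\<Sum>k\<le>n. of_nat (n choose k) * a^k * b^(n-k)) +
      b * (\<Sum>k\<le>n. of_nat (n choose k) * a^k * b^(n-k))"
    by (rule distrib_right)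
  also have "\<dots> = (\<Sum>k\<le>n. of_nat (n choose k) * a^(k+1) * b^(n-k)) +
      (\<Sum>k\<le>n. of_nat (n choose k) * a^k * b^(n - k + 1))"
    by (simp only: sum_distrib_left aterm bterm)
  also have "\<dots> = (\<Sum>k\<le>n. of_nat (n choose k) * a^k * b^(n + 1 - k)) +
      (\<Sum>k=1..n+1. of_nat (n choose (k - 1)) * a^k * b^(n + 1 - k))"
    by (simp add: atMost_atLeast0 sum.shift_bounds_cl_Suc_ivl Suc_diff_le add.commute del: sum.cl_ivl_Suc)
  also have "\<dots> = b^(n + 1) +
      (\<Sum>k=1..n. of_nat (n choose k) * a^k * b^(n + 1 - k)) + (a^(n + 1) +
      (\<Sum>k=1..n. of_nat (n choose (k - 1)) * a^k * b^(n + 1 - k)))"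
      using sum.nat_ivl_Suc' [of 1 n "\<lambda>k. of_nat (n choose (k-1)) * a ^ k * b ^ (n + 1 - k)"]
    by (simp add: sum.atLeast_Suc_atMost atMost_atLeast0)
  also have "\<dots> = a^(n + 1) + b^(n + 1) +
      (\<Sum>k=1..n. of_nat (n + 1 choose k) * a^k * b^(n + 1 - k))"
    by (auto simp add: algebra_simps sum.distrib [symmetric] choose_reduce_nat)
  also have "\<dots> = (\<Sum>k\<le>n+1. of_nat (n + 1 choose k) * a^k * b^(n + 1 - k))"
    using decomp by (simp add: atMost_atLeast0 algebra_simps)
  finally show ?case
    by simp
qed

definition fps_exp_X :: "(complex \<Rightarrow> 'a::ring_1) \<Rightarrow> 'a \<Rightarrow> 'a fps" where
  "fps_exp_X sc y = Abs_fps (\<lambda>n. sc (1 / of_nat (fact n)) * y ^ n)"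

lemma fps_X_times_const_power:
  "(fps_X * fps_const (y::'a::ring_1)) ^ k = fps_X ^ k * fps_const (y ^ k)"
  by (induct k) (simp_all add: fps_mult_fps_X_power_commute mult.assoc flip: fps_const_mult)

lemma fexp_fps_X_times_const: "fexp sc (fps_X * fps_const y) = fps_exp_X sc y"
proof -
  have "s * ((fps_X * fps_const y) ^ k) $ n = (if k = n then s * y ^ n else 0)" for s k n
    by (simp add: fps_X_times_const_power fps_X_power_mult_nth)
  then show ?thesis unfolding fexp_def fps_exp_X_def by simp
qed

lemma fps_exp_X_zero: "cplx_alg sc \<Longrightarrow> fps_exp_X sc 0 = 1"
  by (rule fps_ext) (simp add: fps_exp_X_def cplx_algD power_0_left)

lemma fps_exp_X_add:
  assumes sc: "cplx_alg sc" and yz: "commutes y z"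
  shows "fps_exp_X sc (y + z) = fps_exp_X sc y * fps_exp_X sc z"
proof (rule fps_ext)
  fix n
  have "sc (1 / of_nat (fact i)) * y ^ i * (sc (1 / of_nat (fact (n - i))) * z ^ (n - i))
      = sc (1 / of_nat (fact n)) * (of_nat (n choose i) * y ^ i * z ^ (n - i))" if "i \<le> n" for i
  proof -
    let ?w = "y ^ i * z ^ (n - i)"
    have "y ^ i * (sc (1 / of_nat (fact (n - i))) * z ^ (n - i))
        = sc (1 / of_nat (fact (n - i))) * ?w"
      using cplx_algD(5)[OF sc] unfolding commutes_def by (metis mult.assoc)
    then have "sc (1 / of_nat (fact i)) * y ^ i * (sc (1 / of_nat (fact (n - i))) * z ^ (n - i))
        = sc (1 / of_nat (fact i) * (1 / of_nat (fact (n - i)))) * ?w"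
      by (simp only: mult.assoc cplx_algD(4)[OF sc])
    also have "(1::complex) / of_nat (fact i) * (1 / of_nat (fact (n - i)))
        = 1 / of_nat (fact n) * of_nat (n choose i)"
      using that by (simp add: binomial_fact field_simps)
    finally show ?thesis
      by (simp only: mult.assoc cplx_algD(4)[OF sc] cplx_alg_of_nat[OF sc])
  qed
  then show "fps_exp_X sc (y + z) $ n = (fps_exp_X sc y * fps_exp_X sc z) $ n"
    by (simp add: fps_exp_X_def fps_mult_nth binomial_commuting[OF yz] sum_distrib_left atMost_atLeast0)
qed

lemma prod_list_fexp_fps_X_times_const:
  assumes sc: "cplx_alg sc"
    and pairwise: "\<And>s t. s \<in> set xs \<Longrightarrow> t \<in> set xs \<Longrightarrow> commutes (y s) (y t)"
  shows "prod_list (map (\<lambda>s. fexp sc (fps_X * fps_const (y s))) xs)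
       = fps_exp_X sc (sum_list (map y xs))"
  using pairwise
proof (induct xs)
  case Nil
  then show ?case by (simp add: fps_exp_X_zero[OF sc])
next
  case (Cons x xs)
  have "commutes (y x) (sum_list (map y xs))"
    by (rule commutes_sym, rule commutes_sum_list_left) (simp add: Cons.prems)
  then show ?case
    using Cons by (simp add: fexp_fps_X_times_const fps_exp_X_add[OF sc])
qed

lemma fps_commutes_const_iff: "commutes f (fps_const (d::'a::ring_1)) \<longleftrightarrow> (\<forall>n. commutes (f $ n) d)"
  by (simp add: commutes_def fps_eq_iff)

lemma fps_const_commutes_const:
  "commutes (x::'a::ring_1) d \<Longrightarrow> commutes (fps_const x) (fps_const d)"
  by (simp add: commutes_def)

lemma fps_X_commutes: "commutes fps_X (f::'a::ring_1 fps)"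
  by (simp add: commutes_def fps_mult_fps_X_commute)

lemma fexp_commutes_const:
  assumes sc: "cplx_alg sc" and "commutes A (fps_const d)"
  shows "commutes (fexp sc A) (fps_const d)"
proof -
  have "commutes ((A ^ k) $ n) d" for k n
    using commutes_power_left[OF assms(2)] by (simp add: fps_commutes_const_iff)
  then show ?thesis
    unfolding fps_commutes_const_iff fexp_def
    by (auto intro!: commutes_sum_left commutes_mult_left cplx_algD(5)[OF sc])
qed

lemma fps_exp_X_commutes_const:
  "cplx_alg sc \<Longrightarrow> commutes y d \<Longrightarrow> commutes (fps_exp_X sc y) (fps_const d)"
  unfolding fexp_fps_X_times_const[symmetric]
  by (intro fexp_commutes_const commutes_mult_left fps_X_commutes fps_const_commutes_const)

lemma fln1p_commutes_const:
  assumes sc: "cplx_alg sc" and "commutes x d"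
  shows "commutes (fln1p sc x) (fps_const d)"
  unfolding fps_commutes_const_iff fln1p_def
  by (auto intro!: commutes_mult_left commutes_power_left commutes_zero_left cplx_algD(5)[OF sc] assms(2))

lemma fexp_nth_0: "cplx_alg sc \<Longrightarrow> fexp sc A $ 0 = 1"
  by (simp add: fexp_def cplx_algD)

lemma prod_list_map_nth_0:
  "(\<And>x. x \<in> set xs \<Longrightarrow> f x $ 0 = 1) \<Longrightarrow> prod_list (map f xs) $ 0 = (1::'a::ring_1)"
  by (induct xs) simp_all

lemma fps_conj_eq_if_commutes:
  fixes F :: "'a::ring_1 fps"
  assumes "F $ 0 = 1" and "commutes F D"
  shows "\<exists>G. F * G = 1 \<and> G * F = 1 \<and> F * D * G = D"
proof (intro exI conjI)
  let ?G = "fps_right_inverse F 1"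
  show FG: "F * ?G = 1" using assms(1) by (simp add: fps_right_inverse)
  show "?G * F = 1" using assms(1) fps_left_inverse'[of 1 F 1] by simp
  show "F * D * ?G = D" using assms(2) FG by (simp add: commutes_def mult.assoc)
qed

lemma gl_repD:
  assumes "gl_rep N e" "i \<in> {1..N}" "j \<in> {1..N}" "k \<in> {1..N}" "l \<in> {1..N}"
  shows "e i j * e k l - e k l * e i j = (if j = k then e i l else 0) - (if l = i then e k j else 0)"
  using assms unfolding gl_rep_def by blast

lemma gl_rep_commutes:
  assumes "gl_rep N e" "i \<in> {1..N}" "j \<in> {1..N}" "k \<in> {1..N}" "l \<in> {1..N}"
    and "j \<noteq> k" "l \<noteq> i"
  shows "commutes (e i j) (e k l)"
  using gl_repD[OF assms(1-5)] assms(6,7) by (simp add: commutes_def)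

lemma legs_commuteD:
  assumes "legs_commute N e1 e2" "i \<in> {1..N}" "j \<in> {1..N}" "k \<in> {1..N}" "l \<in> {1..N}"
  shows "commutes (e1 i j) (e2 k l)"
  using assms unfolding legs_commute_def commutes_def by blast

lemma gl_rep_Iden_commutes:
  assumes e: "gl_rep N e" and i: "i \<in> {1..N}" and j: "j \<in> {1..N}"
  shows "commutes (e i j) (Iden N e)"
proof -
  have "e i j * Iden N e - Iden N e * e i j
      = (\<Sum>t=1..N. (if j = t then e i t else 0) - (if t = i then e t j else 0))"
    unfolding Iden_def sum_distrib_left sum_distrib_right sum_subtractf[symmetric]
    by (rule sum.cong) (simp_all add: gl_repD[OF e i j])
  also have "\<dots> = 0"
    using i j by (simp add: sum_subtractf)
  finally show ?thesis by (simp add: commutes_def)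
qed

lemma coproduct_commutes_contraction:
  assumes e1: "gl_rep N e1" and e2: "gl_rep N e2" and legs: "legs_commute N e1 e2"
    and a: "a \<in> {1..N}" and b: "b \<in> {1..N}" and T: "T \<subseteq> {1..N}"
    and aT: "a \<notin> T" and bT: "b \<notin> T" and i: "i \<in> T" and j: "j \<in> T"
  shows "commutes (e1 i j + e2 i j) (\<Sum>s\<in>T. e1 a s * e2 s b)"
proof -
  have iN: "i \<in> {1..N}" and jN: "j \<in> {1..N}" using i j T by auto
  have term_commutator:
    "(e1 i j + e2 i j) * (e1 a s * e2 s b) - (e1 a s * e2 s b) * (e1 i j + e2 i j)
      = (if s = j then e1 a j * e2 i b else 0) - (if s = i then e1 a j * e2 i b else 0)"
    if s: "s \<in> T" for s
  proof -
    have sN: "s \<in> {1..N}" using s T by auto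
    have "e2 i j * (e1 a s * e2 s b) = e1 a s * (e2 i j * e2 s b)"
      and "e1 a s * e2 s b * e1 i j = e1 a s * e1 i j * e2 s b"
      using legs_commuteD[OF legs a sN iN jN] legs_commuteD[OF legs iN jN sN b]
      unfolding commutes_def by (metis mult.assoc)+
    then have "(e1 i j + e2 i j) * (e1 a s * e2 s b) - (e1 a s * e2 s b) * (e1 i j + e2 i j)
        = (e1 i j * e1 a s - e1 a s * e1 i j) * e2 s b + e1 a s * (e2 i j * e2 s b - e2 s b * e2 i j)"
      by (simp only: distrib_left distrib_right) (simp add: algebra_simps)
    also have "\<dots> = (if s = j then e1 a j * e2 i b else 0) - (if s = i then e1 a j * e2 i b else 0)"
      using gl_repD[OF e1 iN jN a sN] gl_repD[OF e2 iN jN sN b] i j aT bT by auto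
    finally show ?thesis .
  qed
  have "(e1 i j + e2 i j) * (\<Sum>s\<in>T. e1 a s * e2 s b) - (\<Sum>s\<in>T. e1 a s * e2 s b) * (e1 i j + e2 i j)
      = (\<Sum>s\<in>T. (if s = j then e1 a j * e2 i b else 0) - (if s = i then e1 a j * e2 i b else 0))"
    unfolding sum_distrib_left sum_distrib_right sum_subtractf[symmetric]
    by (rule sum.cong) (simp_all add: term_commutator)
  also have "\<dots> = 0"
    using i j T finite_subset[OF T] by (simp add: sum_subtractf)
  finally show ?thesis by (simp add: commutes_def)
qed

lemma FP_nth_0: "cplx_alg sc \<Longrightarrow> FP sc N e1 e2 k \<nu> $ 0 = 1"
  unfolding FP_def by (simp add: prod_list_map_nth_0 fexp_nth_0)

lemma FPchain_nth_0: "cplx_alg sc \<Longrightarrow> FPchain sc N e1 e2 p \<nu> $ 0 = 1"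
  unfolding FPchain_def by (simp add: prod_list_map_nth_0 FP_nth_0)

lemma commutes_scalar_combination:
  assumes sc: "cplx_alg sc" and w: "\<And>i j. i \<in> S \<Longrightarrow> j \<in> S \<Longrightarrow> commutes w (x i j)"
  shows "commutes w (\<Sum>i\<in>S. \<Sum>j\<in>S. sc (c i j) * x i j)"
  by (rule commutes_sym)
    (intro commutes_sum_left commutes_mult_left cplx_algD(5)[OF sc] commutes_sym[OF w])

lemma HP_commutes_coproduct:
  assumes sc: "cplx_alg sc" and e1: "gl_rep N e1" and legs: "legs_commute N e1 e2"
    and "a \<in> {1..N}" "i \<in> {1..N}" "j \<in> {1..N}" "i \<noteq> a" "j \<noteq> a"
  shows "commutes (HP sc N e1 a) (e1 i j + e2 i j)"
  unfolding HP_def using assms(4-)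
  by (intro commutes_diff_left commutes_mult_left commutes_add_right cplx_algD(5)[OF sc]
      gl_rep_commutes[OF e1] legs_commuteD[OF legs] commutes_sym[OF gl_rep_Iden_commutes[OF e1]])
    (auto simp: Iden_def intro!: commutes_sum_left legs_commuteD[OF legs])

lemma FP_eq_exp_contraction:
  assumes sc: "cplx_alg sc" and e1: "gl_rep N e1" and e2: "gl_rep N e2"
    and legs: "legs_commute N e1 e2" and "k < N"
  shows "FP sc N e1 e2 k \<nu>
       = fps_exp_X sc (sc \<nu> * (\<Sum>s\<in>{k+2..<N-k}. e1 (k+1) s * e2 s (N-k)))
         * fexp sc (fps_const (HP sc N e1 (k+1)) * sigmaP sc e2 (k+1) (N-k) \<nu>)"
proof -
  define y where "y s = sc \<nu> * e1 (k+1) s * e2 s (N-k)" for s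
  have "commutes (y s) (y t)" if "s \<in> set [k+2..<N-k]" "t \<in> set [k+2..<N-k]" for s t
  proof -
    have "k+1 \<in> {1..N}" "N-k \<in> {1..N}" "s \<in> {1..N}" "t \<in> {1..N}"
      and "s \<noteq> k+1" "t \<noteq> k+1" "N-k \<noteq> s" "N-k \<noteq> t"
      using that \<open>k < N\<close> by auto
    then show ?thesis
      unfolding y_def
      by (intro commutes_mult_left commutes_mult_right cplx_algD(5)[OF sc]
          commutes_sym[OF cplx_algD(5)[OF sc]] gl_rep_commutes[OF e1] gl_rep_commutes[OF e2]
          legs_commuteD[OF legs] commutes_sym[OF legs_commuteD[OF legs]])
  qed
  then have "prod_list (map (\<lambda>s. fexp sc (fps_X * fps_const (y s))) [k+2..<N-k])
      = fps_exp_X sc (sum_list (map y [k+2..<N-k]))"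
    by (rule prod_list_fexp_fps_X_times_const[OF sc])
  also have "sum_list (map y [k+2..<N-k]) = sc \<nu> * (\<Sum>s\<in>{k+2..<N-k}. e1 (k+1) s * e2 s (N-k))"
    by (simp add: y_def mult.assoc sum_distrib_left flip: sum_set_upt_conv_sum_list_nat)
  finally show ?thesis
    unfolding FP_def y_def by simp
qed

lemma FP_commutes_coproduct_sum:
  fixes c :: "nat \<Rightarrow> nat \<Rightarrow> complex"
  assumes sc: "cplx_alg sc" and e1: "gl_rep N e1" and e2: "gl_rep N e2"
    and legs: "legs_commute N e1 e2" and "k < N" and S: "S \<subseteq> {k+2..<N-k}"
  shows "commutes (FP sc N e1 e2 k \<nu>)
           (fps_const (\<Sum>i\<in>S. \<Sum>j\<in>S. sc (c i j) * (e1 i j + e2 i j)))"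
proof -
  define a b T D where "a = k + 1" and "b = N - k" and "T = {k+2..<N-k}"
    and "D = (\<Sum>i\<in>S. \<Sum>j\<in>S. sc (c i j) * (e1 i j + e2 i j))"
  have a: "a \<in> {1..N}" and b: "b \<in> {1..N}" using \<open>k < N\<close> by (auto simp: a_def b_def)
  have T: "T \<subseteq> {1..N}" and aT: "a \<notin> T" and bT: "b \<notin> T"
    by (auto simp: T_def a_def b_def)
  have commutes_D: "commutes w D"
    if "\<And>i j. i \<in> T \<Longrightarrow> j \<in> T \<Longrightarrow> commutes w (e1 i j + e2 i j)" for w
    unfolding D_def using S by (intro commutes_scalar_combination[OF sc] that) (auto simp: T_def)
  have Y: "commutes (sc \<nu> * (\<Sum>s\<in>T. e1 a s * e2 s b)) D"
    by (intro commutes_D commutes_mult_left cplx_algD(5)[OF sc]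
        commutes_sym[OF coproduct_commutes_contraction[OF e1 e2 legs a b T aT bT]])
  have H: "commutes (HP sc N e1 a) D"
    using T aT by (intro commutes_D HP_commutes_coproduct[OF sc e1 legs a]) auto
  have E: "commutes (sc \<nu> * e2 a b) D"
  proof (rule commutes_D)
    fix i j assume "i \<in> T" "j \<in> T"
    then have "i \<in> {1..N}" "j \<in> {1..N}" "b \<noteq> i" "j \<noteq> a" using T aT bT by auto
    then show "commutes (sc \<nu> * e2 a b) (e1 i j + e2 i j)"
      by (intro commutes_mult_left commutes_add_right cplx_algD(5)[OF sc]
          commutes_sym[OF legs_commuteD[OF legs]] gl_rep_commutes[OF e2] a b)
  qed
  have "FP sc N e1 e2 k \<nu> = fps_exp_X sc (sc \<nu> * (\<Sum>s\<in>T. e1 a s * e2 s b))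
      * fexp sc (fps_const (HP sc N e1 a) * fln1p sc (sc \<nu> * e2 a b))"
    using FP_eq_exp_contraction[OF sc e1 e2 legs \<open>k < N\<close>] by (simp add: a_def b_def T_def sigmaP_def)
  also have "commutes \<dots> (fps_const D)"
    by (intro commutes_mult_left fps_exp_X_commutes_const[OF sc Y] fexp_commutes_const[OF sc]
        fps_const_commutes_const[OF H] fln1p_commutes_const[OF sc E])
  finally show ?thesis unfolding D_def .
qed

lemma FPchain_commutes_coproduct_sum:
  fixes c :: "nat \<Rightarrow> nat \<Rightarrow> complex"
  assumes "cplx_alg sc" "gl_rep N e1" "gl_rep N e2" "legs_commute N e1 e2" and "p < N"
  shows "commutes (FPchain sc N e1 e2 p \<nu>)
           (fps_const (\<Sum>i\<in>{p+2..N-p-1}. \<Sum>j\<in>{p+2..N-p-1}. sc (c i j) * (e1 i j + e2 i j)))"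
  unfolding FPchain_def
  using \<open>p < N\<close> by (intro commutes_prod_list_left) (auto intro!: FP_commutes_coproduct_sum[OF assms(1-4)])

theorem mainTheorem3:
  fixes sc :: "complex \<Rightarrow> 'a::ring_1"
    and e1 e2 :: "nat \<Rightarrow> nat \<Rightarrow> 'a"
    and N p :: nat and \<nu> :: "nat \<Rightarrow> complex" and c :: "nat \<Rightarrow> nat \<Rightarrow> complex"
  assumes "cplx_alg sc" and "gl_rep N e1" and "gl_rep N e2" and "legs_commute N e1 e2"
    and "N \<ge> 3" and "p \<le> N div 2 - 1"
    and "(\<Sum>i\<in>{p+2..N-p-1}. c i i) = 0"
  shows "let F = FPchain sc N e1 e2 p \<nu>;
             D = fps_const (\<Sum>i\<in>{p+2..N-p-1}. \<Sum>j\<in>{p+2..N-p-1}. sc (c i j) * (e1 i j + e2 i j))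
         in \<exists>G. F * G = 1 \<and> G * F = 1 \<and> F * D * G = D"
proof -
  have "p < N" using assms(5,6) by linarith
  then show ?thesis
    unfolding Let_def
    by (intro fps_conj_eq_if_commutes FPchain_nth_0[OF assms(1)]
        FPchain_commutes_coproduct_sum[OF assms(1-4)])
qed

end
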